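(* Let $n \ge 0$ and let $X$ be a partial group with $n+1$ elements (i.e. $|X_1| = n+1$). Then $X$ is $n$-skeletal. If moreover $X$ is actually a group, then $X$ has dimension $n$.
   Context: Let $\mathbf{\Upsilon}$ be the category with objects $[n]=\{0,1,\dots,n\}$ for $n\ge 0$ and with all functions as morphisms. A symmetric set is a functor $X\colon \mathbf{\Upsilon}^{\mathrm{op}}\to \mathsf{Set}$; write $X_n$ for $X([n])$, and for $\alpha\colon[m]\to[n]$ write $x\mapsto x\cdot\alpha$ for the induced map $X_n\to X_m$. For $x\in X_n$ and $i,j\in[n]$, write $x_{ij}=x\cdot\alpha\in X_1$ where $\alpha\colon[1]\to[n]$, $\alpha(0)=i$, $\alpha(1)=j$. For $n\ge 1$, a spine of $[n]$ is a tree $T$ with vertex set $[n]$; it gives a map $\mathscr{E}_T$ from $X_n$ to $\prod_{\{i,j\}\in T}X_1$ (product over the edges of $T$) whose $\{i,j\}$-component, for $i<j$, is $x\mapsto x_{ij}$. (Its image lies in the limit of the induced diagram, i.e. the subset of families of edges with matching endpoints; injectivity is unaffected by the choice of codomain.) $X$ is spiny if $\mathscr{E}_T$ is injective for every $n\ge1$ and every spine $T$ of $[n]$. A partial group is a spiny symmetric set $X$ that is reduced, meaning $X_0$ has exactly one element; its elements are the elements of $X_1$. A partial group $X$ is a group if it is isomorphic, as a symmetric set, to the nerve of a group $G$ regarded as a one-object groupoid; here the nerve of a groupoid $\mathcal{G}$ has as $n$-simplices the functors to $\mathcal{G}$ from the groupoid with object set $[n]$ and exactly one morphism between any two objects. A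 symmetric subset of $X$ is a subfunctor. For $X$ nonempty and $n\ge0$, $\mathrm{sk}_nX$ is the smallest symmetric subset of $X$ containing all of $X_n$, and $X$ is $n$-skeletal if $\mathrm{sk}_nX=X$. $X$ has dimension $n$ if it is $n$-skeletal but not $(n-1)$-skeletal (with the convention that a nonempty $X$ is never $(-1)$-skeletal). *)

theory Defs
  imports "HOL-Library.FuncSet" "HOL-Algebra.Group"
begin

text \<open>
  The category of symmetric sets is built over the sets \<open>[n] = {..n}\<close> with all functions as
  morphisms.  Morphisms \<open>[m] \<rightarrow> [n]\<close> are represented by extensional functions, so that
  equality of morphisms is HOL equality.
\<close>

definition Hom :: "nat \<Rightarrow> nat \<Rightarrow> (nat \<Rightarrow> nat) set" where
  "Hom m n = {..m} \<rightarrow>\<^sub>E {..n}"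

text \<open>
  For \<open>\<alpha> \<in> Hom m n\<close> the map \<open>act X m n \<alpha>\<close> goes from \<open>simplices X n\<close> to \<open>simplices X m\<close>.  Its values
  outside these sets are irrelevant.  The sets \<open>simplices X n\<close> for different \<open>n\<close> need not be disjoint.
\<close>

record 'a symset =
  simplices :: "nat \<Rightarrow> 'a set"
  act :: "nat \<Rightarrow> nat \<Rightarrow> (nat \<Rightarrow> nat) \<Rightarrow> 'a \<Rightarrow> 'a"

locale symmetric_set =
  fixes X :: "'a symset"
  assumes act_closed:
      "\<And>m n \<alpha> x. \<alpha> \<in> Hom m n \<Longrightarrow> x \<in> simplices X n \<Longrightarrow> act X m n \<alpha> x \<in> simplices X m"
    and act_id:
      "\<And>n x. x \<in> simplices X n \<Longrightarrow> act X n n (\<lambda>i\<in>{..n}. i) x = x"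
    and act_comp:
      "\<And>l m n \<alpha> \<beta> x. \<alpha> \<in> Hom m n \<Longrightarrow> \<beta> \<in> Hom l m \<Longrightarrow> x \<in> simplices X n \<Longrightarrow>
         act X l n (compose {..l} \<alpha> \<beta>) x = act X l m \<beta> (act X m n \<alpha> x)"

text \<open>The edge \<open>x\<^sub>i\<^sub>j\<close> of an \<open>n\<close>-simplex \<open>x\<close>.\<close>

definition edge :: "'a symset \<Rightarrow> nat \<Rightarrow> 'a \<Rightarrow> nat \<Rightarrow> nat \<Rightarrow> 'a" where
  "edge X n x i j = act X 1 n (\<lambda>k\<in>{..1}. if k = 0 then i else j) x"

definition graph_cycle :: "nat set set \<Rightarrow> nat list \<Rightarrow> bool" where
  "graph_cycle T vs \<longleftrightarrow> 3 \<le> length vs \<and> distinct vs \<and>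
     (\<forall>i<length vs. {vs ! i, vs ! (Suc i mod length vs)} \<in> T)"

text \<open>A tree with vertex set \<open>[n]\<close>, given by its set of edges: connected and without cycles.\<close>

definition spine :: "nat \<Rightarrow> nat set set \<Rightarrow> bool" where
  "spine n T \<longleftrightarrow>
     (\<forall>e\<in>T. e \<subseteq> {..n} \<and> card e = 2) \<and>
     (\<forall>u\<le>n. \<forall>v\<le>n. (u, v) \<in> {(a, b). {a, b} \<in> T}\<^sup>*) \<and>
     (\<nexists>vs. graph_cycle T vs)"

definition spine_map :: "'a symset \<Rightarrow> nat \<Rightarrow> nat set set \<Rightarrow> 'a \<Rightarrow> nat set \<Rightarrow> 'a" where
  "spine_map X n T x = (\<lambda>e\<in>T. edge X n x (Min e) (Max e))"

definition spiny :: "'a symset \<Rightarrow> bool" where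
  "spiny X \<longleftrightarrow> (\<forall>n\<ge>1. \<forall>T. spine n T \<longrightarrow> inj_on (spine_map X n T) (simplices X n))"

definition reduced :: "'a symset \<Rightarrow> bool" where
  "reduced X \<longleftrightarrow> (\<exists>!x. x \<in> simplices X 0)"

definition partial_group :: "'a symset \<Rightarrow> bool" where
  "partial_group X \<longleftrightarrow> symmetric_set X \<and> spiny X \<and> reduced X"

definition symset_iso :: "'a symset \<Rightarrow> 'b symset \<Rightarrow> bool" where
  "symset_iso X Y \<longleftrightarrow> (\<exists>\<phi>.
     (\<forall>n. bij_betw (\<phi> n) (simplices X n) (simplices Y n)) \<and>
     (\<forall>m n. \<forall>\<alpha>\<in>Hom m n. \<forall>x\<in>simplices X n. \<phi> m (act X m n \<alpha> x) = act Y m n \<alpha> (\<phi> n x)))"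

text \<open>
  The groupoid with object set \<open>[n]\<close> and exactly one morphism between any two objects has the pairs
  \<open>(i, j)\<close> as its morphisms \<open>i \<rightarrow> j\<close>.  As \<open>G\<close> has a single object, a functor to \<open>G\<close> is determined by its
  values on morphisms; composition in \<open>G\<close> is the product, with the morphism applied last on
  the left.
\<close>

definition nerve :: "('g, 'b) monoid_scheme \<Rightarrow> (nat \<times> nat \<Rightarrow> 'g) symset" where
  "nerve G = \<lparr>
     simplices = (\<lambda>n. {F \<in> {..n} \<times> {..n} \<rightarrow>\<^sub>E carrier G.
        (\<forall>i\<le>n. F (i, i) = \<one>\<^bsub>G\<^esub>) \<and>
        (\<forall>i\<le>n. \<forall>j\<le>n. \<forall>k\<le>n. F (i, k) = F (j, k) \<otimes>\<^bsub>G\<^esub> F (i, j))}),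
     act = (\<lambda>m n \<alpha> F. \<lambda>(i, j)\<in>{..m} \<times> {..m}. F (\<alpha> i, \<alpha> j))\<rparr>"

text \<open>
  The carrier of a group whose nerve is isomorphic to \<open>X\<close> is in bijection with \<open>simplices X 1\<close>, so it is
  no restriction to take its elements in the type \<open>'a\<close>; see \<open>is_groupI\<close> below.
\<close>

definition is_group :: "'a symset \<Rightarrow> bool" where
  "is_group X \<longleftrightarrow> (\<exists>G :: 'a monoid. group G \<and> symset_iso X (nerve G))"

lemma symset_iso_trans:
  assumes XY: "symset_iso X Y" and YZ: "symset_iso Y Z"
  shows "symset_iso X Z"
proof -
  obtain \<phi> where \<phi>: "\<And>n. bij_betw (\<phi> n) (simplices X n) (simplices Y n)"
    and \<phi>_act: "\<And>m n \<alpha> x. \<alpha> \<in> Hom m n \<Longrightarrow> x \<in> simplices X n \<Longrightarrow>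
      \<phi> m (act X m n \<alpha> x) = act Y m n \<alpha> (\<phi> n x)"
    using XY unfolding symset_iso_def by blast
  obtain \<psi> where \<psi>: "\<And>n. bij_betw (\<psi> n) (simplices Y n) (simplices Z n)"
    and \<psi>_act: "\<And>m n \<alpha> y. \<alpha> \<in> Hom m n \<Longrightarrow> y \<in> simplices Y n \<Longrightarrow>
      \<psi> m (act Y m n \<alpha> y) = act Z m n \<alpha> (\<psi> n y)"
    using YZ unfolding symset_iso_def by blast
  have "bij_betw (\<psi> n \<circ> \<phi> n) (simplices X n) (simplices Z n)" for n
    using \<phi> \<psi> by (rule bij_betw_trans)
  moreover have "(\<psi> m \<circ> \<phi> m) (act X m n \<alpha> x) = act Z m n \<alpha> ((\<psi> n \<circ> \<phi> n) x)"
    if "\<alpha> \<in> Hom m n" "x \<in> simplices X n" for m n \<alpha> x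
    using that \<phi>_act \<psi>_act bij_betwE[OF \<phi>] by simp
  ultimately show ?thesis
    unfolding symset_iso_def by (intro exI[of _ "\<lambda>n. \<psi> n \<circ> \<phi> n"]) blast
qed

lemma nerve_simplexD:
  assumes "F \<in> simplices (nerve G) n"
  shows "F \<in> {..n} \<times> {..n} \<rightarrow>\<^sub>E carrier G"
    and "\<And>i j. i \<le> n \<Longrightarrow> j \<le> n \<Longrightarrow> F (i, j) \<in> carrier G"
    and "\<And>i. i \<le> n \<Longrightarrow> F (i, i) = \<one>\<^bsub>G\<^esub>"
    and "\<And>i j k. i \<le> n \<Longrightarrow> j \<le> n \<Longrightarrow> k \<le> n \<Longrightarrow> F (i, k) = F (j, k) \<otimes>\<^bsub>G\<^esub> F (i, j)"
proof -
  show *: "F \<in> {..n} \<times> {..n} \<rightarrow>\<^sub>E carrier G"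
    using assms unfolding nerve_def by simp
  show "F (i, j) \<in> carrier G" if "i \<le> n" "j \<le> n" for i j
    using PiE_mem[OF *, of "(i, j)"] that by simp
  show "F (i, i) = \<one>\<^bsub>G\<^esub>" if "i \<le> n" for i
    using assms that unfolding nerve_def symset.simps by blast
  show "F (i, k) = F (j, k) \<otimes>\<^bsub>G\<^esub> F (i, j)" if "i \<le> n" "j \<le> n" "k \<le> n" for i j k
    using assms that unfolding nerve_def symset.simps by blast
qed

lemma nerve_simplexI:
  assumes "F \<in> {..n} \<times> {..n} \<rightarrow>\<^sub>E carrier G"
    and "\<And>i. i \<le> n \<Longrightarrow> F (i, i) = \<one>\<^bsub>G\<^esub>"
    and "\<And>i j k. i \<le> n \<Longrightarrow> j \<le> n \<Longrightarrow> k \<le> n \<Longrightarrow> F (i, k) = F (j, k) \<otimes>\<^bsub>G\<^esub> F (i, j)"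
  shows "F \<in> simplices (nerve G) n"
  using assms unfolding nerve_def symset.simps by blast

lemma nerve_map:
  assumes G: "group G" and H: "group H" and h: "h \<in> hom G H" and F: "F \<in> simplices (nerve G) n"
  shows "(\<lambda>p\<in>{..n} \<times> {..n}. h (F p)) \<in> simplices (nerve H) n"
proof (rule nerve_simplexI)
  note F = nerve_simplexD[OF F]
  show "(\<lambda>p\<in>{..n} \<times> {..n}. h (F p)) \<in> {..n} \<times> {..n} \<rightarrow>\<^sub>E carrier H"
    using F(2) hom_in_carrier[OF h] by auto
  show "(\<lambda>p\<in>{..n} \<times> {..n}. h (F p)) (i, i) = \<one>\<^bsub>H\<^esub>" if "i \<le> n" for i
    using that F(3) hom_one[OF h G H] by simp
  show "(\<lambda>p\<in>{..n} \<times> {..n}. h (F p)) (i, k) =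
      (\<lambda>p\<in>{..n} \<times> {..n}. h (F p)) (j, k) \<otimes>\<^bsub>H\<^esub> (\<lambda>p\<in>{..n} \<times> {..n}. h (F p)) (i, j)"
    if "i \<le> n" "j \<le> n" "k \<le> n" for i j k
    using that F(2) F(4)[of i j k] hom_mult[OF h] by simp
qed

lemma nerve_iso:
  assumes G: "group G" and H: "group H" and h: "h \<in> iso G H"
  shows "symset_iso (nerve G) (nerve H)"
proof -
  define k where "k = inv_into (carrier G) h"
  have hh: "h \<in> hom G H" and bij: "bij_betw h (carrier G) (carrier H)"
    using h by (auto simp: iso_def)
  have k: "k \<in> hom H G"
    using group.iso_set_sym[OF G h] by (auto simp: iso_def k_def)
  have hk: "h (k y) = y" if "y \<in> carrier H" for y
    using bij_betw_inv_into_right[OF bij that] by (simp add: k_def)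
  have kh: "k (h x) = x" if "x \<in> carrier G" for x
    using bij_betw_inv_into_left[OF bij that] by (simp add: k_def)
  define \<Phi> :: "nat \<Rightarrow> (nat \<times> nat \<Rightarrow> 'a) \<Rightarrow> nat \<times> nat \<Rightarrow> 'c"
    where "\<Phi> n F = (\<lambda>p\<in>{..n} \<times> {..n}. h (F p))" for n F
  define \<Psi> :: "nat \<Rightarrow> (nat \<times> nat \<Rightarrow> 'c) \<Rightarrow> nat \<times> nat \<Rightarrow> 'a"
    where "\<Psi> n F = (\<lambda>p\<in>{..n} \<times> {..n}. k (F p))" for n F
  have ext_G: "F \<in> {..n} \<times> {..n} \<rightarrow>\<^sub>E carrier G" if "F \<in> simplices (nerve G) n" for F n
    using that by (rule nerve_simplexD)
  have ext_H: "F \<in> {..n} \<times> {..n} \<rightarrow>\<^sub>E carrier H" if "F \<in> simplices (nerve H) n" for F n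
    using that by (rule nerve_simplexD)
  have inv1: "\<Psi> n (\<Phi> n F) = F" if "F \<in> simplices (nerve G) n" for F n
    using PiE_mem[OF ext_G[OF that]] PiE_arb[OF ext_G[OF that]] kh
    by (simp add: \<Phi>_def \<Psi>_def fun_eq_iff restrict_def)
  have inv2: "\<Phi> n (\<Psi> n F) = F" if "F \<in> simplices (nerve H) n" for F n
    using PiE_mem[OF ext_H[OF that]] PiE_arb[OF ext_H[OF that]] hk
    by (simp add: \<Phi>_def \<Psi>_def fun_eq_iff restrict_def)
  have "bij_betw (\<Phi> n) (simplices (nerve G) n) (simplices (nerve H) n)" for n
    by (rule bij_betw_byWitness[where f' = "\<Psi> n"])
      (use inv1 inv2 nerve_map[OF G H hh] nerve_map[OF H G k] in \<open>auto simp: \<Phi>_def \<Psi>_def\<close>)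
  moreover have "\<Phi> m (act (nerve G) m n \<alpha> F) = act (nerve H) m n \<alpha> (\<Phi> n F)"
    if "\<alpha> \<in> Hom m n" for m n \<alpha> F
    using that by (auto simp: \<Phi>_def nerve_def Hom_def fun_eq_iff PiE_iff)
  ultimately show ?thesis
    unfolding symset_iso_def by blast
qed

lemma bij_nerve_1:
  fixes G (structure)
  assumes "group G"
  shows "bij_betw (\<lambda>F. F (0, 1)) (simplices (nerve G) 1) (carrier G)"
proof -
  interpret group G by fact
  have le1: "i \<le> 1 \<longleftrightarrow> i = 0 \<or> i = 1" for i :: nat by auto
  define \<Psi> where "\<Psi> g = (\<lambda>p\<in>{..1::nat} \<times> {..1::nat}.
     if p = (0, 1) then g else if p = (1, 0) then inv g else \<one>)" for g
  have mem: "\<Psi> g \<in> simplices (nerve G) 1" if "g \<in> carrier G" for g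
    using that by (intro nerve_simplexI) (auto simp: \<Psi>_def le1)
  have "\<Psi> (F (0, 1)) = F" if F: "F \<in> simplices (nerve G) 1" for F
  proof
    fix p :: "nat \<times> nat"
    note c = nerve_simplexD(2)[OF F]
    have "F (1, 0) \<otimes> F (0, 1) = F (0, 0)" and one: "F (0, 0) = \<one>" "F (1, 1) = \<one>"
      using nerve_simplexD(3)[OF F] nerve_simplexD(4)[OF F, of 0 1 0] by simp_all
    then have "F (1, 0) = inv (F (0, 1))"
      using inv_equality[of "F (1, 0)" "F (0, 1)"] c by simp
    moreover have "F p = undefined" if "p \<notin> {..1} \<times> {..1}"
      using nerve_simplexD(1)[OF F] that by (rule PiE_arb)
    ultimately show "\<Psi> (F (0, 1)) p = F p"
      using one by (cases p) (auto simp: \<Psi>_def le1 le_Suc_eq)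
  qed
  moreover have "\<Psi> g (0, 1) = g" for g
    by (simp add: \<Psi>_def)
  moreover have "F (0, 1) \<in> carrier G" if "F \<in> simplices (nerve G) 1" for F
    using nerve_simplexD(2)[OF that] by simp
  ultimately show ?thesis
    using mem by (intro bij_betw_byWitness[where f' = \<Psi>]) auto
qed

lemma is_groupI:
  fixes X :: "'a symset" and G :: "'g monoid"
  assumes G: "group G" and X: "symset_iso X (nerve G)"
  shows "is_group X"
proof -
  obtain \<phi> where "bij_betw \<phi> (simplices X 1) (simplices (nerve G) 1)"
    using X unfolding symset_iso_def by blast
  from bij_betw_trans[OF this bij_nerve_1[OF G]]
  obtain f where f: "bij_betw f (simplices X 1) (carrier G)"
    by blast
  define h where "h = inv_into (simplices X 1) f"
  have bij: "bij_betw h (carrier G) (simplices X 1)"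
    unfolding h_def using f by (rule bij_betw_inv_into)
  have fh: "f (h g) = g" if "g \<in> carrier G" for g
    unfolding h_def using bij_betw_inv_into_right[OF f that] .
  define H0 :: "'a monoid" where
    "H0 = \<lparr>carrier = simplices X 1, mult = (\<lambda>x y. h (f x \<otimes>\<^bsub>G\<^esub> f y)), one = h \<one>\<^bsub>G\<^esub>\<rparr>"
  have h: "h \<in> iso G H0"
    using bij fh bij_betwE[OF bij] by (auto simp: iso_def hom_def H0_def)
  have "group (H0\<lparr>one := h \<one>\<^bsub>G\<^esub>\<rparr>)"
    using group.iso_imp_img_group[OF G h] .
  then have H: "group H0"
    by (simp add: H0_def)
  show ?thesis
    unfolding is_group_def
    using H symset_iso_trans[OF X nerve_iso[OF G H h]] by blast
qed

definition symmetric_subset :: "(nat \<Rightarrow> 'a set) \<Rightarrow> 'a symset \<Rightarrow> bool" where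
  "symmetric_subset Y X \<longleftrightarrow>
     (\<forall>n. Y n \<subseteq> simplices X n) \<and>
     (\<forall>m n. \<forall>\<alpha>\<in>Hom m n. \<forall>x\<in>Y n. act X m n \<alpha> x \<in> Y m)"

definition sk :: "nat \<Rightarrow> 'a symset \<Rightarrow> 'a symset" where
  "sk n X = X\<lparr>simplices :=
     (\<lambda>m. \<Inter>{Y m |Y. symmetric_subset Y X \<and> simplices X n \<subseteq> Y n})\<rparr>"

definition skeletal :: "nat \<Rightarrow> 'a symset \<Rightarrow> bool" where
  "skeletal n X \<longleftrightarrow> sk n X = X"

text \<open>
  For nonempty \<open>X\<close>; there is no condition on \<open>n - 1\<close> if \<open>n = 0\<close>, as such an \<open>X\<close> is never
  \<open>(-1)\<close>-skeletal.
\<close>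

definition has_dimension :: "'a symset \<Rightarrow> nat \<Rightarrow> bool" where
  "has_dimension X n \<longleftrightarrow> skeletal n X \<and> (n \<noteq> 0 \<longrightarrow> \<not> skeletal (n - 1) X)"

end

theory Submission
  imports Defs
begin

text \<open>
  A simplex \<open>x\<close> of a spiny symmetric set is determined by the edges \<open>x\<^sub>0\<^sub>j\<close>, because the star with
  centre \<open>0\<close> is a spine (\<open>spine_star\<close>).  Hence if \<open>x\<^sub>0\<^sub>i = x\<^sub>0\<^sub>j\<close>, the vertex \<open>j\<close> of \<open>x\<close> is a repetition of
  the vertex \<open>i\<close>: sending every vertex \<open>j\<close> to a chosen vertex with the same edge from \<open>0\<close> leaves \<open>x\<close>
  unchanged.  The number of vertices that remain is at most the number of edges of \<open>X\<close>.  So when there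
  are \<open>n + 1\<close> edges, \<open>x\<close> is obtained from an \<open>n\<close>-simplex by repeating vertices, which is exactly
  membership in the \<open>n\<close>-skeleton (\<open>skeletal_iff\<close>).

  The bound is attained by a group \<open>G\<close>.  Listing its elements as \<open>g\<^sub>0, \<dots>, g\<^sub>n\<close> gives an \<open>n\<close>-simplex
  of the nerve whose edge from \<open>i\<close> to \<open>j\<close> is \<open>g\<^sub>j g\<^sub>i\<inverse>\<close> (\<open>nerve_simplex_of_vertices\<close>).  Its edges from
  \<open>0\<close> are pairwise distinct, whereas a simplex pulled back along a map \<open>[n] \<rightarrow> [n - 1]\<close> repeats a
  vertex and therefore an edge.
\<close>

section \<open>Skeleta\<close>

text \<open>
  The pullbacks of \<open>n\<close>-simplices are closed under the action, since actions compose, so they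
  already form the smallest symmetric subset containing the \<open>n\<close>-simplices.
\<close>

lemma simplices_sk:
  assumes "symmetric_set X"
  shows "simplices (sk n X) m = {act X m n \<rho> y |\<rho> y. \<rho> \<in> Hom m n \<and> y \<in> simplices X n}"
proof -
  interpret symmetric_set X by fact
  define Y where "Y m = {act X m n \<rho> y |\<rho> y. \<rho> \<in> Hom m n \<and> y \<in> simplices X n}" for m
  have closed: "act X k m \<alpha> x \<in> Y k" if \<alpha>: "\<alpha> \<in> Hom k m" and x: "x \<in> Y m" for k m \<alpha> x
  proof -
    from x obtain \<rho> y where \<rho>: "\<rho> \<in> Hom m n" and y: "y \<in> simplices X n" "x = act X m n \<rho> y"
      unfolding Y_def by blast
    have "act X k m \<alpha> x = act X k n (compose {..k} \<rho> \<alpha>) y"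
      using act_comp[OF \<rho> \<alpha> y(1)] y(2) by simp
    moreover have "compose {..k} \<rho> \<alpha> \<in> Hom k n"
      using \<alpha> \<rho> by (auto simp: Hom_def compose_def PiE_iff)
    ultimately show ?thesis
      unfolding Y_def using y(1) by blast
  qed
  have "symmetric_subset Y X"
    unfolding symmetric_subset_def using closed act_closed by (auto simp: Y_def)
  moreover have "simplices X n \<subseteq> Y n"
  proof
    fix x assume x: "x \<in> simplices X n"
    have "(\<lambda>i\<in>{..n}. i) \<in> Hom n n"
      by (simp add: Hom_def)
    then show "x \<in> Y n"
      unfolding Y_def using act_id[OF x, symmetric] x by blast
  qed
  moreover have "Y m \<subseteq> Z m" if "symmetric_subset Z X" "simplices X n \<subseteq> Z n" for Z
    using that unfolding symmetric_subset_def Y_def by blast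
  ultimately have "\<Inter>{Z m |Z. symmetric_subset Z X \<and> simplices X n \<subseteq> Z n} = Y m"
    by blast
  then show ?thesis
    by (simp add: sk_def Y_def)
qed

lemma skeletal_iff:
  assumes "symmetric_set X"
  shows "skeletal n X \<longleftrightarrow>
    (\<forall>m. \<forall>x\<in>simplices X m. \<exists>\<rho>\<in>Hom m n. \<exists>y\<in>simplices X n. x = act X m n \<rho> y)"
proof -
  interpret symmetric_set X by fact
  have "skeletal n X \<longleftrightarrow> (\<forall>m. simplices (sk n X) m = simplices X m)"
  proof
    assume "\<forall>m. simplices (sk n X) m = simplices X m"
    then have "simplices (sk n X) = simplices X"
      by blast
    then show "skeletal n X"
      by (simp add: skeletal_def sk_def)
  qed (simp add: skeletal_def)
  also have "\<dots> \<longleftrightarrow> (\<forall>m. simplices X m \<subseteq> simplices (sk n X) m)"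
    using act_closed unfolding simplices_sk[OF assms] by blast
  finally show ?thesis
    unfolding simplices_sk[OF assms] by blast
qed

section \<open>Simplices of spiny symmetric sets\<close>

text \<open>
  A cycle has at least three edges, and not all of them can contain the centre, as the centre
  occurs in the cycle only once.
\<close>

lemma spine_star: "spine n ((\<lambda>j. {0, j}) ` {1..n})"
proof -
  define T :: "nat set set" where "T = (\<lambda>j. {0, j}) ` {1..n}"
  have "(u, v) \<in> {(a, b). {a, b} \<in> T}\<^sup>*" if "u \<le> n" "v \<le> n" for u v
  proof -
    have "(u, 0) \<in> {(a, b). {a, b} \<in> T}\<^sup>*"
      using that(1) by (cases "u = 0") (auto simp: T_def insert_commute intro!: r_into_rtrancl)
    moreover have "(0, v) \<in> {(a, b). {a, b} \<in> T}\<^sup>*"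
      using that(2) by (cases "v = 0") (auto simp: T_def intro!: r_into_rtrancl)
    ultimately show ?thesis
      by (rule rtrancl_trans)
  qed
  moreover have "\<not> graph_cycle T vs" for vs
  proof
    assume "graph_cycle T vs"
    then have len: "3 \<le> length vs" and dist: "distinct vs"
      and edges: "\<And>i. i < length vs \<Longrightarrow> {vs ! i, vs ! (Suc i mod length vs)} \<in> T"
      by (auto simp: graph_cycle_def)
    have centre: "vs ! i = 0 \<or> vs ! (Suc i mod length vs) = 0" if "i < length vs" for i
      using edges[OF that] by (auto simp: T_def doubleton_eq_iff)
    have next_lt: "Suc i mod length vs < length vs" for i
      using len by (intro mod_less_divisor) auto
    have unique: "i = j" if "i < length vs" "j < length vs" "vs ! i = 0" "vs ! j = 0" for i j
      using dist that nth_eq_iff_index_eq by metis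
    have "vs \<noteq> []"
      using len by auto
    let ?k = "Suc 2 mod length vs"
    have "vs ! 0 = 0 \<or> vs ! 1 = 0"
      using centre[of 0] len mod_less[of 1 "length vs"] by fastforce
    moreover have "vs ! 1 = 0 \<or> vs ! 2 = 0"
      using centre[of 1] len by (auto simp: numeral_2_eq_2)
    moreover have "vs ! 2 = 0 \<or> vs ! ?k = 0"
      using centre[of 2] len by auto
    moreover have "\<not> (vs ! 0 = 0 \<and> vs ! 1 = 0)"
      using unique[of 0 1] len \<open>vs \<noteq> []\<close> by auto
    moreover have "\<not> (vs ! 0 = 0 \<and> vs ! 2 = 0)"
      using unique[of 0 2] len \<open>vs \<noteq> []\<close> by auto
    moreover have "\<not> (vs ! 1 = 0 \<and> vs ! 2 = 0)"
      using unique[of 1 2] len by auto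
    moreover have "\<not> (vs ! 1 = 0 \<and> vs ! ?k = 0)"
    proof -
      have "?k \<noteq> 1"
        using len by (cases "length vs = 3") simp_all
      then show ?thesis
        using unique[of 1 ?k] next_lt[of 2] len by linarith
    qed
    ultimately show False
      by blast
  qed
  moreover have "e \<subseteq> {..n} \<and> card e = 2" if "e \<in> T" for e
    using that by (auto simp: T_def)
  ultimately show ?thesis
    unfolding spine_def T_def[symmetric] by blast
qed

lemma spiny_eqI:
  assumes "spiny X" "1 \<le> n" "x \<in> simplices X n" "y \<in> simplices X n"
    and eq: "\<And>j. j \<in> {1..n} \<Longrightarrow> edge X n x 0 j = edge X n y 0 j"
  shows "x = y"
proof -
  let ?T = "(\<lambda>j. {0, j}) ` {1..n}"
  have "inj_on (spine_map X n ?T) (simplices X n)"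
    using assms(1,2) spine_star unfolding spiny_def by blast
  moreover have "spine_map X n ?T x = spine_map X n ?T y"
    using eq by (auto simp: spine_map_def fun_eq_iff)
  ultimately show ?thesis
    using assms(3,4) by (simp add: inj_on_def)
qed

lemma (in symmetric_set) edge_act:
  assumes \<alpha>: "\<alpha> \<in> Hom m k" and x: "x \<in> simplices X k" and ij: "i \<le> m" "j \<le> m"
  shows "edge X m (act X m k \<alpha> x) i j = edge X k x (\<alpha> i) (\<alpha> j)"
proof -
  let ?\<beta> = "\<lambda>l\<in>{..1}. if l = (0::nat) then i else j"
  have "?\<beta> \<in> Hom 1 m"
    using ij by (auto simp: Hom_def)
  moreover have "compose {..1} \<alpha> ?\<beta> = (\<lambda>l\<in>{..1}. if l = 0 then \<alpha> i else \<alpha> j)"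
    by (auto simp: compose_def fun_eq_iff)
  ultimately show ?thesis
    using act_comp[OF \<alpha> _ x, of ?\<beta> 1] by (simp add: edge_def)
qed

lemma Hom_factor:
  assumes \<gamma>: "\<gamma> \<in> Hom m k" and card: "card (\<gamma> ` {..m}) \<le> n + 1"
  obtains \<rho> \<iota> where "\<rho> \<in> Hom m n" "\<iota> \<in> Hom n k" "compose {..m} \<iota> \<rho> = \<gamma>"
proof -
  let ?A = "\<gamma> ` {..m}"
  obtain e where e: "e ` ?A \<subseteq> {..n}" "inj_on e ?A"
    using card_le_inj[of ?A "{..n}"] card by auto
  define \<rho> where "\<rho> = (\<lambda>i\<in>{..m}. e (\<gamma> i))"
  \<comment> \<open>Vertices of \<open>[n]\<close> outside the image of \<open>e\<close> can be sent anywhere, for instance to \<open>0\<close>.\<close>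
  define \<iota> where "\<iota> = (\<lambda>l\<in>{..n}. if l \<in> e ` ?A then inv_into ?A e l else 0)"
  have "inv_into ?A e l \<le> k" if "l \<in> e ` ?A" for l
    using inv_into_into[OF that] \<gamma> by (auto simp: Hom_def PiE_iff)
  then have "\<iota> \<in> Hom n k"
    by (auto simp: \<iota>_def Hom_def simp del: image_iff)
  moreover have "\<rho> \<in> Hom m n"
    using e(1) by (auto simp: \<rho>_def Hom_def)
  moreover have "compose {..m} \<iota> \<rho> = \<gamma>"
  proof
    fix i show "compose {..m} \<iota> \<rho> i = \<gamma> i"
    proof (cases "i \<le> m")
      case True
      then have "\<gamma> i \<in> ?A" "e (\<gamma> i) \<le> n"
        using e(1) by auto
      then show ?thesis
        using True inv_into_f_f[OF e(2)] by (simp add: compose_def \<rho>_def \<iota>_def)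
    next
      case False
      then show ?thesis
        using \<gamma> by (auto simp: compose_def Hom_def PiE_iff extensional_def)
    qed
  qed
  ultimately show ?thesis
    using that by blast
qed

text \<open>
  The retraction \<open>\<gamma>\<close> below sends a vertex \<open>j\<close> to the least vertex with the same edge from \<open>0\<close>.
  It fixes \<open>0\<close>, so the edges from \<open>0\<close> of \<open>x \<cdot> \<gamma>\<close> are those of \<open>x\<close>, whence \<open>x \<cdot> \<gamma> = x\<close>.  Since the edges
  from \<open>0\<close> are distinct on its image, \<open>\<gamma>\<close> factors through \<open>[n]\<close>.
\<close>

theorem spiny_skeletal:
  assumes "symmetric_set X" and "spiny X"
    and fin: "finite (simplices X 1)" and card: "card (simplices X 1) \<le> n + 1"
  shows "skeletal n X"
  unfolding skeletal_iff[OF assms(1)]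
proof (intro allI ballI)
  interpret symmetric_set X by fact
  fix m x assume x: "x \<in> simplices X m"
  let ?e = "edge X m x 0"
  define \<gamma> where "\<gamma> = (\<lambda>j\<in>{..m}. LEAST i. ?e i = ?e j)"
  have edge_\<gamma>: "?e (\<gamma> j) = ?e j" and \<gamma>_le: "\<gamma> j \<le> j" if "j \<le> m" for j
    using that LeastI[of "\<lambda>i. ?e i = ?e j" j] Least_le[of "\<lambda>i. ?e i = ?e j" j]
    by (simp_all add: \<gamma>_def)
  have \<gamma>: "\<gamma> \<in> Hom m m"
    using \<gamma>_le order_trans by (fastforce simp: Hom_def \<gamma>_def)
  have x\<gamma>: "act X m m \<gamma> x = x"
  proof (cases "m = 0")
    \<comment> \<open>Spininess says nothing about \<open>X\<^sub>0\<close>, but for \<open>m = 0\<close> the only map \<open>[0] \<rightarrow> [0]\<close> is the identity.\<close>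
    case True
    then have "\<gamma> = (\<lambda>i\<in>{..m}. i)"
      using \<gamma>_le[of 0] \<gamma> by (auto simp: fun_eq_iff Hom_def PiE_iff extensional_def)
    then show ?thesis
      using act_id[OF x] by simp
  next
    case False
    show ?thesis
    proof (rule spiny_eqI[OF \<open>spiny X\<close>])
      show "edge X m (act X m m \<gamma> x) 0 j = ?e j" if "j \<in> {1..m}" for j
        using edge_act[OF \<gamma> x, of 0 j] \<gamma>_le[of 0] edge_\<gamma>[of j] that by simp
    qed (use False x act_closed[OF \<gamma> x] in auto)
  qed
  have "inj_on ?e (\<gamma> ` {..m})"
  proof (rule inj_onI, elim imageE)
    fix i j a b assume "?e a = ?e b" "a = \<gamma> i" "b = \<gamma> j" "i \<in> {..m}" "j \<in> {..m}"
    moreover from this have "?e i = ?e j"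
      using edge_\<gamma>[of i] edge_\<gamma>[of j] by simp
    ultimately show "a = b"
      by (simp add: \<gamma>_def)
  qed
  moreover have "?e ` \<gamma> ` {..m} \<subseteq> simplices X 1"
  proof -
    have "?e j \<in> simplices X 1" if "j \<le> m" for j
      unfolding edge_def by (rule act_closed[OF _ x]) (use that in \<open>auto simp: Hom_def\<close>)
    then show ?thesis
      using edge_\<gamma> by auto
  qed
  ultimately have "card (\<gamma> ` {..m}) \<le> n + 1"
    using card_inj_on_le[OF _ _ fin] card order_trans by blast
  then obtain \<rho> \<iota> where \<rho>: "\<rho> \<in> Hom m n" and \<iota>: "\<iota> \<in> Hom n m" "compose {..m} \<iota> \<rho> = \<gamma>"
    using Hom_factor[OF \<gamma>] by metis
  have "x = act X m n \<rho> (act X n m \<iota> x)"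
    using act_comp[OF \<iota>(1) \<rho> x] \<iota>(2) x\<gamma> by simp
  then show "\<exists>\<rho>\<in>Hom m n. \<exists>y\<in>simplices X n. x = act X m n \<rho> y"
    using \<rho> act_closed[OF \<iota>(1) x] by blast
qed

section \<open>Groups\<close>

lemma nerve_simplex_of_vertices:
  fixes G (structure)
  assumes "group G" and g: "\<And>i. i \<le> n \<Longrightarrow> g i \<in> carrier G"
  shows "(\<lambda>(i, j)\<in>{..n} \<times> {..n}. g j \<otimes> inv (g i)) \<in> simplices (nerve G) n"
proof -
  interpret group G by fact
  have mult: "g k \<otimes> inv (g i) = (g k \<otimes> inv (g j)) \<otimes> (g j \<otimes> inv (g i))"
    if "i \<le> n" "j \<le> n" "k \<le> n" for i j k
  proof -
    have "inv (g j) \<otimes> (g j \<otimes> inv (g i)) = inv (g i)"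
      using g[OF that(1)] g[OF that(2)] by (simp flip: m_assoc)
    then show ?thesis
      using g[OF that(1)] g[OF that(2)] g[OF that(3)] by (simp add: m_assoc)
  qed
  show ?thesis
  proof (rule nerve_simplexI)
    show "(\<lambda>(i, j)\<in>{..n} \<times> {..n}. g j \<otimes> inv (g i)) (i, k) =
        (\<lambda>(i, j)\<in>{..n} \<times> {..n}. g j \<otimes> inv (g i)) (j, k) \<otimes>
        (\<lambda>(i, j)\<in>{..n} \<times> {..n}. g j \<otimes> inv (g i)) (i, j)"
      if "i \<le> n" "j \<le> n" "k \<le> n" for i j k
      using that mult[OF that] by simp
  qed (use g in auto)
qed

text \<open>
  The simplex with vertices \<open>g\<^sub>0, \<dots>, g\<^sub>n\<close> cannot repeat a vertex, because its edge from \<open>0\<close> to \<open>j\<close> is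
  \<open>g\<^sub>j g\<^sub>0\<inverse>\<close>.  Only \<open>n + 1\<close> distinct elements enter, so it follows also that the nerve of an infinite
  group is not \<open>k\<close>-skeletal for any \<open>k\<close>.
\<close>

lemma group_not_skeletal:
  fixes G :: "('g, 'b) monoid_scheme" (structure)
  assumes "symmetric_set X" and "group G" and iso: "symset_iso X (nerve G)"
    and inj: "inj_on g {..n}" and g: "\<And>i. i \<le> n \<Longrightarrow> g i \<in> carrier G"
    and "k < n"
  shows "\<not> skeletal k X"
proof
  interpret group G by fact
  assume skel: "skeletal k X"
  obtain \<phi> where \<phi>: "\<And>m. bij_betw (\<phi> m) (simplices X m) (simplices (nerve G) m)"
    and \<phi>_act: "\<And>l m \<alpha> x. \<alpha> \<in> Hom l m \<Longrightarrow> x \<in> simplices X m \<Longrightarrow>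
      \<phi> l (act X l m \<alpha> x) = act (nerve G) l m \<alpha> (\<phi> m x)"
    using iso unfolding symset_iso_def by blast
  define F where "F = (\<lambda>(i, j)\<in>{..n} \<times> {..n}. g j \<otimes> inv (g i))"
  have "F \<in> simplices (nerve G) n"
    unfolding F_def using nerve_simplex_of_vertices[OF \<open>group G\<close> g] .
  then obtain x where x: "x \<in> simplices X n" "\<phi> n x = F"
    using bij_betw_imp_surj_on[OF \<phi>[of n]] by (metis imageE)
  obtain \<rho> y where \<rho>: "\<rho> \<in> Hom n k" and y: "y \<in> simplices X k" "x = act X n k \<rho> y"
    using skel x(1) unfolding skeletal_iff[OF assms(1)] by blast
  have F_eq: "F = act (nerve G) n k \<rho> (\<phi> k y)"
    using \<phi>_act[OF \<rho> y(1)] y(2) x(2) by simp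
  have "\<rho> ` {..n} \<subseteq> {..k}"
    using \<rho> by (auto simp: Hom_def)
  then have "card (\<rho> ` {..n}) < card {..n}"
    using card_mono[of "{..k}" "\<rho> ` {..n}"] \<open>k < n\<close> by simp
  then obtain i j where ij: "i \<le> n" "j \<le> n" "i \<noteq> j" "\<rho> i = \<rho> j"
    using pigeonhole[of \<rho> "{..n}"] by (auto simp: inj_on_def)
  then have "F (0, i) = F (0, j)"
    by (simp add: F_eq nerve_def)
  then have "g i = g j"
    using ij g[of 0] g[of i] g[of j] by (simp add: F_def)
  then show False
    using inj ij by (auto simp: inj_on_def)
qed

theorem corollary15:
  fixes X :: "'a symset" and n :: nat
  assumes "partial_group X"
    and "card (simplices X 1) = n + 1"
  shows "skeletal n X \<and> (is_group X \<longrightarrow> has_dimension X n)"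
proof (intro conjI impI)
  have X: "symmetric_set X" "spiny X"
    using assms(1) by (auto simp: partial_group_def)
  have "finite (simplices X 1)"
    using assms(2) card.infinite by fastforce
  then show skel: "skeletal n X"
    using spiny_skeletal[OF X] assms(2) by simp
  assume "is_group X"
  then obtain G :: "'a monoid" where G: "group G" and iso: "symset_iso X (nerve G)"
    unfolding is_group_def by blast
  have "card (carrier G) = n + 1"
  proof -
    obtain \<phi> where "bij_betw \<phi> (simplices X 1) (simplices (nerve G) 1)"
      using iso unfolding symset_iso_def by blast
    then show ?thesis
      using bij_betw_same_card[of \<phi>] bij_betw_same_card[OF bij_nerve_1[OF G]] assms(2) by simp
  qed
  moreover from this have "finite (carrier G)"
    using card.infinite by fastforce
  ultimately obtain g where g: "bij_betw g {..n} (carrier G)"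
    using finite_same_card_bij[of "{..n}" "carrier G"] by auto
  have "\<not> skeletal (n - 1) X" if "n \<noteq> 0"
    by (rule group_not_skeletal[OF X(1) G iso])
      (use g that in \<open>auto simp: bij_betw_def\<close>)
  then show "has_dimension X n"
    using skel by (simp add: has_dimension_def)
qed

end
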